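(* Let $G$ be an Abelian topological group and let $\pi:X\to Y$ be a tame extension of minimal $G$-systems. Then, up to isomorphism, $\pi$ has a unique decomposition $\pi=\varphi\circ\psi$, with $\psi:X\to Z$ and $\varphi:Z\to Y$ extensions of $G$-systems, such that $\psi$ is proximal and $\varphi$ is equicontinuous. If furthermore $X$ is metrizable, or $\pi$ is open and $Y$ is metrizable, then $\psi$ is highly proximal.
   Context: A $G$-system is a compact Hausdorff space with a continuous $G$-action; minimal means every orbit is dense. An extension $\pi:X\to Y$ is a continuous surjective $G$-equivariant map. $R_\pi=\{(x_1,x_2):\pi(x_1)=\pi(x_2)\}$, $\Delta_2(X)=\{(x,x)\}$. For $A_1,A_2\subseteq X$, $J\subseteq G$ is an independence set if for every nonempty finite $I\subseteq J$ and $\sigma:I\to\{1,2\}$, $\bigcap_{s\in I}s^{-1}A_{\sigma(s)}\neq\emptyset$; ${\rm IT}_2(X,G)$ is the set of $(x,y)$ such that for all neighbourhoods $U\ni x$, $V\ni y$, $(U,V)$ has an infinite independence set. $\pi$ is tame if $({\rm IT}_2(X,G)\cap R_\pi)\setminus\Delta_2(X)=\emptyset$. $\psi$ is proximal if for every $(x_1,x_2)\in R_\psi$ the orbit closure $\overline{G(x_1,x_2)}$ meets the diagonal. $\varphi:Z\to Y$ is equicontinuous if for every neighbourhood $\varepsilon$ of the diagonal in $Z\times Z$ there is a neighbourhood $\delta$ of the diagonal with $s(\delta\cap R_\varphi)\subseteq\varepsilon$ for all $s\in G$. $\psi:X\to Z$ is highly proximal if for every nonempty open $U\subseteq X$ and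 every $z\in Z$ there is $s\in G$ with $\psi^{-1}(z)\subseteq sU$. Uniqueness up to isomorphism means that for any two such decompositions $\varphi\circ\psi=\varphi'\circ\psi'$ through $Z$ and $Z'$ there is a $G$-equivariant homeomorphism $h:Z\to Z'$ with $h\circ\psi=\psi'$ and $\varphi'\circ h=\varphi$. *)

theory Defs
  imports "HOL-Analysis.Analysis"
begin

definition G_system :: "'a topology \<Rightarrow> ('g::topological_ab_group_add \<Rightarrow> 'a \<Rightarrow> 'a) \<Rightarrow> bool" where
  "G_system X act \<longleftrightarrow>
     compact_space X \<and> Hausdorff_space X \<and>
     continuous_map (prod_topology (euclidean :: 'g topology) X) X (\<lambda>(g, x). act g x) \<and>
     (\<forall>x\<in>topspace X. act 0 x = x) \<and>
     (\<forall>g h. \<forall>x\<in>topspace X. act (g + h) x = act g (act h x))"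

definition orbit :: "('g \<Rightarrow> 'a \<Rightarrow> 'a) \<Rightarrow> 'a \<Rightarrow> 'a set" where
  "orbit act x = range (\<lambda>g. act g x)"

definition minimal_G_system :: "'a topology \<Rightarrow> ('g::topological_ab_group_add \<Rightarrow> 'a \<Rightarrow> 'a) \<Rightarrow> bool" where
  "minimal_G_system X act \<longleftrightarrow> G_system X act \<and>
     (\<forall>x\<in>topspace X. X closure_of (orbit act x) = topspace X)"

definition extension ::
  "'a topology \<Rightarrow> ('g \<Rightarrow> 'a \<Rightarrow> 'a) \<Rightarrow> 'b topology \<Rightarrow> ('g \<Rightarrow> 'b \<Rightarrow> 'b) \<Rightarrow> ('a \<Rightarrow> 'b) \<Rightarrow> bool" where
  "extension X actX Y actY p \<longleftrightarrow>
     continuous_map X Y p \<and> p ` topspace X = topspace Y \<and>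
     (\<forall>g. \<forall>x\<in>topspace X. p (actX g x) = actY g (p x))"

definition independence_set ::
  "'a topology \<Rightarrow> ('g \<Rightarrow> 'a \<Rightarrow> 'a) \<Rightarrow> 'a set \<Rightarrow> 'a set \<Rightarrow> 'g set \<Rightarrow> bool" where
  "independence_set X act A1 A2 J \<longleftrightarrow>
     (\<forall>I. finite I \<and> I \<noteq> {} \<and> I \<subseteq> J \<longrightarrow>
        (\<forall>\<sigma> :: 'g \<Rightarrow> bool.
           (\<Inter>s\<in>I. {x \<in> topspace X. act s x \<in> (if \<sigma> s then A1 else A2)}) \<noteq> {}))"

definition IT2 :: "'a topology \<Rightarrow> ('g \<Rightarrow> 'a \<Rightarrow> 'a) \<Rightarrow> ('a \<times> 'a) set" where
  "IT2 X act = {(x, y). x \<in> topspace X \<and> y \<in> topspace X \<and>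
     (\<forall>U V. openin X U \<and> x \<in> U \<and> openin X V \<and> y \<in> V \<longrightarrow>
        (\<exists>J. infinite J \<and> independence_set X act U V J))}"

definition Rel :: "'a topology \<Rightarrow> ('a \<Rightarrow> 'b) \<Rightarrow> ('a \<times> 'a) set" where
  "Rel X p = {(x1, x2). x1 \<in> topspace X \<and> x2 \<in> topspace X \<and> p x1 = p x2}"

definition diag :: "'a topology \<Rightarrow> ('a \<times> 'a) set" where
  "diag X = {(x, x) | x. x \<in> topspace X}"

definition tame_ext :: "'a topology \<Rightarrow> ('g \<Rightarrow> 'a \<Rightarrow> 'a) \<Rightarrow> ('a \<Rightarrow> 'b) \<Rightarrow> bool" where
  "tame_ext X act p \<longleftrightarrow> (IT2 X act \<inter> Rel X p) - diag X = {}"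

definition proximal_ext :: "'a topology \<Rightarrow> ('g \<Rightarrow> 'a \<Rightarrow> 'a) \<Rightarrow> ('a \<Rightarrow> 'b) \<Rightarrow> bool" where
  "proximal_ext X act p \<longleftrightarrow>
     (\<forall>(x1, x2) \<in> Rel X p.
        (prod_topology X X) closure_of (range (\<lambda>g. (act g x1, act g x2))) \<inter> diag X \<noteq> {})"

definition diag_nbhd :: "'a topology \<Rightarrow> ('a \<times> 'a) set \<Rightarrow> bool" where
  "diag_nbhd Z E \<longleftrightarrow> E \<subseteq> topspace Z \<times> topspace Z \<and>
     (\<exists>W. openin (prod_topology Z Z) W \<and> diag Z \<subseteq> W \<and> W \<subseteq> E)"

definition equicontinuous_ext :: "'a topology \<Rightarrow> ('g \<Rightarrow> 'a \<Rightarrow> 'a) \<Rightarrow> ('a \<Rightarrow> 'b) \<Rightarrow> bool" where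
  "equicontinuous_ext Z act p \<longleftrightarrow>
     (\<forall>\<epsilon>. diag_nbhd Z \<epsilon> \<longrightarrow>
        (\<exists>\<delta>. diag_nbhd Z \<delta> \<and>
           (\<forall>s. (\<lambda>(z1, z2). (act s z1, act s z2)) ` (\<delta> \<inter> Rel Z p) \<subseteq> \<epsilon>)))"

definition highly_proximal_ext ::
  "'a topology \<Rightarrow> ('g \<Rightarrow> 'a \<Rightarrow> 'a) \<Rightarrow> 'b topology \<Rightarrow> ('a \<Rightarrow> 'b) \<Rightarrow> bool" where
  "highly_proximal_ext X act Z p \<longleftrightarrow>
     (\<forall>U. openin X U \<and> U \<noteq> {} \<longrightarrow>
        (\<forall>z\<in>topspace Z. \<exists>s. {x \<in> topspace X. p x = z} \<subseteq> act s ` U))"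

definition PE_decomposition ::
  "'a topology \<Rightarrow> ('g::topological_ab_group_add \<Rightarrow> 'a \<Rightarrow> 'a) \<Rightarrow> 'b topology \<Rightarrow> ('g \<Rightarrow> 'b \<Rightarrow> 'b) \<Rightarrow> ('a \<Rightarrow> 'b)
   \<Rightarrow> 'c topology \<Rightarrow> ('g \<Rightarrow> 'c \<Rightarrow> 'c) \<Rightarrow> ('a \<Rightarrow> 'c) \<Rightarrow> ('c \<Rightarrow> 'b) \<Rightarrow> bool" where
  "PE_decomposition X actX Y actY p Z actZ psi phi \<longleftrightarrow>
     G_system Z actZ \<and>
     extension X actX Z actZ psi \<and> extension Z actZ Y actY phi \<and>
     (\<forall>x\<in>topspace X. p x = phi (psi x)) \<and>
     proximal_ext X actX psi \<and> equicontinuous_ext Z actZ phi"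

end

theory Submission
  imports Defs
begin

text \<open>
  For a minimal action of an abelian group, the return-time sets \<open>{s. s O \<inter> O \<noteq> {}}\<close> of nonempty
  open sets \<open>O\<close> form a filter base. Let \<open>a\<close> and \<open>b\<close> be related if every neighbourhood of \<open>a\<close> can be
  moved to meet every neighbourhood of \<open>b\<close> by a return time of every \<open>O\<close>; this closed relation
  contains the regionally proximal one. If in a neighbourhood of \<open>x\<close> it were generically possible
  to move to a neighbourhood of \<open>y\<close> by return times, adding up return times would build an
  infinite independence set. So tameness gives, for distinct \<open>x\<close> and \<open>y\<close> in a fibre of \<open>\<pi>\<close>, rectangles
  around \<open>(x, y)\<close> that the relation avoids over a dense open set, and by compactness every nonempty
  open \<open>U\<close> contains a nonempty open \<open>W\<close> such that points of \<open>W\<close> are related, within their fibre, to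
  points of \<open>U\<close> only. Minimality turns this into: the relation, restricted to the fibres of
  \<open>\<pi>\<close>, is the proximal relation, is transitive, and its quotient map is highly proximal. The quotient is equicontinuous over \<open>Y\<close> because regionally proximal pairs
  have been collapsed. In any decomposition the first map collapses precisely the
  proximal pairs in the fibres of \<open>\<pi>\<close>, whence uniqueness.
\<close>

section \<open>Preliminaries from set theory and topology\<close>

text \<open>Here \<open>P\<close> will say that a finite set realises all its independence patterns.
  Dependent choice gives a strictly increasing chain of finite \<open>P\<close>-sets; a finite
  subset of the union lies in one member, so \<open>anti\<close> applies.\<close>

lemma infinite_set_by_finite_extension:
  assumes empty: "P {}"
    and step: "\<And>F. finite F \<Longrightarrow> P F \<Longrightarrow> \<exists>s. s \<notin> F \<and> P (insert s F)"
    and anti: "\<And>F F'. finite F \<Longrightarrow> P F \<Longrightarrow> F' \<subseteq> F \<Longrightarrow> P F'"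
  shows "\<exists>J. infinite J \<and> (\<forall>I. finite I \<and> I \<subseteq> J \<longrightarrow> P I)"
proof -
  have "\<exists>f. \<forall>n. (finite (f n) \<and> P (f n)) \<and> f n \<subset> f (Suc n)"
  proof (rule dependent_nat_choice)
    show "\<exists>F. finite F \<and> P F"
      using empty by (intro exI[of _ "{}"]) simp
    show "\<exists>F'. (finite F' \<and> P F') \<and> F \<subset> F'" if "finite F \<and> P F" for F n
    proof -
      obtain s where "s \<notin> F" "P (insert s F)"
        using step \<open>finite F \<and> P F\<close> by metis
      then show ?thesis
        using \<open>finite F \<and> P F\<close> by (intro exI[of _ "insert s F"]) blast
    qed
  qed
  then obtain f where "\<forall>n. (finite (f n) \<and> P (f n)) \<and> f n \<subset> f (Suc n)" ..
  then have f: "\<And>n. finite (f n)" "\<And>n. P (f n)" "\<And>n. f n \<subset> f (Suc n)"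
    by simp_all
  then have smono: "strict_mono f"
    by (simp add: strict_mono_Suc_iff)
  then have mono: "mono f"
    by (rule strict_mono_mono)
  have "infinite (\<Union>n. f n)"
  proof
    assume "finite (\<Union>n. f n)"
    then have "finite (Pow (\<Union>n. f n))"
      by simp
    moreover have "range f \<subseteq> Pow (\<Union>n. f n)"
      by blast
    ultimately have "finite (range f)"
      using finite_subset by blast
    moreover have "inj f"
      using smono by (rule strict_mono_imp_inj_on)
    ultimately show False
      using finite_imageD by auto
  qed
  moreover have "\<exists>n. I \<subseteq> f n" if "finite I" "I \<subseteq> (\<Union>n. f n)" for I
    using that
  proof (induction I rule: finite_induct)
    case empty
    then show ?case by simp
  next
    case (insert i I)
    then obtain m n where "I \<subseteq> f m" "i \<in> f n"
      by auto
    moreover have "f m \<subseteq> f (max m n)" "f n \<subseteq> f (max m n)"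
      using mono by (simp_all add: monoD)
    ultimately show ?case
      by blast
  qed
  ultimately show ?thesis
    using anti f by meson
qed

lemma closedin_Rel:
  assumes "Hausdorff_space Y" "continuous_map X Y p"
  shows "closedin (prod_topology X X) (Rel X p)"
proof -
  have "Rel X p = {z \<in> topspace (prod_topology X X). (p \<circ> fst) z = (p \<circ> snd) z}"
    by (auto simp: Rel_def)
  then show ?thesis
    using closedin_continuous_maps_eq[OF assms(1)
        continuous_map_compose[OF continuous_map_fst assms(2)]
        continuous_map_compose[OF continuous_map_snd assms(2)]] by simp
qed

lemma compactin_finite_subfamily:
  assumes "compactin X K" "K \<subseteq> (\<Union>i\<in>I. f i)" "\<And>i. i \<in> I \<Longrightarrow> openin X (f i)"
  obtains J where "finite J" "J \<subseteq> I" "K \<subseteq> (\<Union>i\<in>J. f i)"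
proof -
  have "\<exists>\<F>. finite \<F> \<and> \<F> \<subseteq> f ` I \<and> K \<subseteq> \<Union>\<F>"
    using assms by (intro compactinD) auto
  then obtain \<F> where "finite \<F>" "\<F> \<subseteq> f ` I" "K \<subseteq> \<Union>\<F>"
    by auto
  moreover from this obtain J where "J \<subseteq> I" "finite J" "\<F> = f ` J"
    using finite_subset_image[of \<F> f I] by auto
  ultimately show ?thesis
    using that by simp
qed

section \<open>Quotients of compact Hausdorff spaces\<close>

text \<open>The carrier is the image of \<open>q\<close>, not the whole target type, so that a space
  of equivalence classes can live on a type of sets.\<close>

definition quot_topology :: "'a topology \<Rightarrow> ('a \<Rightarrow> 'b) \<Rightarrow> 'b topology" where
  "quot_topology X q = topology (\<lambda>T. T \<subseteq> q ` topspace X \<and> openin X {x \<in> topspace X. q x \<in> T})"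

lemma openin_quot_topology:
  "openin (quot_topology X q) T \<longleftrightarrow> T \<subseteq> q ` topspace X \<and> openin X {x \<in> topspace X. q x \<in> T}"
proof -
  have "istopology (\<lambda>T. T \<subseteq> q ` topspace X \<and> openin X {x \<in> topspace X. q x \<in> T})"
    unfolding istopology_def
  proof (intro conjI allI impI)
    fix S T
    assume "S \<subseteq> q ` topspace X \<and> openin X {x \<in> topspace X. q x \<in> S}"
      and "T \<subseteq> q ` topspace X \<and> openin X {x \<in> topspace X. q x \<in> T}"
    moreover have "{x \<in> topspace X. q x \<in> S \<inter> T} =
        {x \<in> topspace X. q x \<in> S} \<inter> {x \<in> topspace X. q x \<in> T}"
      by auto
    ultimately show "S \<inter> T \<subseteq> q ` topspace X" "openin X {x \<in> topspace X. q x \<in> S \<inter> T}"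
      by auto
  next
    fix \<K>
    assume *: "\<forall>K\<in>\<K>. K \<subseteq> q ` topspace X \<and> openin X {x \<in> topspace X. q x \<in> K}"
    then show "\<Union>\<K> \<subseteq> q ` topspace X"
      by auto
    have "{x \<in> topspace X. q x \<in> \<Union>\<K>} = (\<Union>K\<in>\<K>. {x \<in> topspace X. q x \<in> K})"
      by auto
    then show "openin X {x \<in> topspace X. q x \<in> \<Union>\<K>}"
      using * by auto
  qed
  then show ?thesis
    by (simp add: quot_topology_def)
qed

lemma topspace_quot_topology [simp]: "topspace (quot_topology X q) = q ` topspace X"
proof -
  have "{x \<in> topspace X. q x \<in> q ` topspace X} = topspace X"
    by auto
  then have "openin (quot_topology X q) (q ` topspace X)"
    by (simp add: openin_quot_topology)
  then show ?thesis
    using openin_quot_topology[of X q "topspace (quot_topology X q)"] openin_subset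
    by (intro antisym) auto
qed

lemma quotient_map_quot_topology: "quotient_map X (quot_topology X q) q"
  by (auto simp: quotient_map_def openin_quot_topology)

text \<open>The saturation of a closed \<open>C\<close> is the projection of a closed subset of the
  product, and projection along a compact factor is closed; hence \<open>q\<close> is closed.
  Normality then passes to \<open>Z\<close>, and closed images of points make \<open>Z\<close> T1,
  hence Hausdorff.\<close>

lemma quotient_by_closed_relation:
  assumes compact: "compact_space X" and Hausdorff: "Hausdorff_space X" and q: "quotient_map X Z q"
    and clo: "closedin (prod_topology X X) (Rel X q)"
  shows "Hausdorff_space Z" "closed_map X Z q"
proof -
  have img: "q ` topspace X = topspace Z"
    using q by (simp add: quotient_map_def)
  have "closedin Z (q ` C)" if C: "closedin X C" for C
  proof -
    have sub: "C \<subseteq> topspace X"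
      using C closedin_subset by blast
    have "closedin (prod_topology X X) (Rel X q \<inter> C \<times> topspace X)"
      using C clo by (intro closedin_Int) (auto simp: closedin_prod_Times_iff)
    then have "closedin X (snd ` (Rel X q \<inter> C \<times> topspace X))"
      using closed_map_snd[OF compact] unfolding closed_map_def by blast
    moreover have "snd ` (Rel X q \<inter> C \<times> topspace X) = {x \<in> topspace X. q x \<in> q ` C}"
    proof (intro equalityI subsetI)
      fix y assume "y \<in> snd ` (Rel X q \<inter> C \<times> topspace X)"
      then obtain x where "(x, y) \<in> Rel X q" "x \<in> C"
        by auto
      then show "y \<in> {x \<in> topspace X. q x \<in> q ` C}"
        by (auto simp: Rel_def intro: rev_image_eqI)
    next
      fix y assume "y \<in> {x \<in> topspace X. q x \<in> q ` C}"
      then obtain x where "x \<in> C" "q y = q x" "y \<in> topspace X"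
        by auto
      then have "(x, y) \<in> Rel X q \<inter> C \<times> topspace X"
        using sub by (auto simp: Rel_def)
      then show "y \<in> snd ` (Rel X q \<inter> C \<times> topspace X)"
        by (rule rev_image_eqI) simp
    qed
    ultimately show ?thesis
      using q image_mono[OF sub, of q] unfolding quotient_map_closedin by simp
  qed
  then show closed: "closed_map X Z q"
    by (simp add: closed_map_def)
  have "t1_space Z"
    unfolding t1_space_closedin_singleton
  proof
    fix z assume "z \<in> topspace Z"
    then obtain x where "x \<in> topspace X" "z = q x"
      using img by auto
    moreover have "closedin X {x}" if "x \<in> topspace X" for x
      using Hausdorff that by (simp add: Hausdorff_imp_t1_space closedin_t1_singleton)
    ultimately show "closedin Z {z}"
      using closed unfolding closed_map_def by (metis image_empty image_insert)
  qed
  moreover have "normal_space Z"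
    using normal_space_continuous_closed_map_image[OF _ quotient_imp_continuous_map[OF q] closed img]
      compact Hausdorff compact_Hausdorff_or_regular_imp_normal_space by blast
  ultimately show "Hausdorff_space Z"
    by (rule normal_t1_imp_Hausdorff_space[rotated])
qed

lemma homeomorphic_quotients:
  assumes q: "quotient_map X Z q" and q': "quotient_map X Z' q'" and eq: "Rel X q = Rel X q'"
  shows "\<exists>h. homeomorphic_map Z Z' h \<and> (\<forall>x\<in>topspace X. h (q x) = q' x)"
proof -
  have *: "q x = q y \<longleftrightarrow> q' x = q' y" if "x \<in> topspace X" "y \<in> topspace X" for x y
  proof -
    have "(x, y) \<in> Rel X q \<longleftrightarrow> (x, y) \<in> Rel X q'"
      by (simp add: eq)
    then show ?thesis
      using that by (simp add: Rel_def)
  qed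
  obtain h where h: "continuous_map Z Z' h" "\<And>x. x \<in> topspace X \<Longrightarrow> h (q x) = q' x"
    using quotient_map_lift_exists[OF q quotient_imp_continuous_map[OF q']] * by metis
  obtain k where k: "continuous_map Z' Z k" "\<And>x. x \<in> topspace X \<Longrightarrow> k (q' x) = q x"
    using quotient_map_lift_exists[OF q' quotient_imp_continuous_map[OF q]] * by metis
  have "q ` topspace X = topspace Z" "q' ` topspace X = topspace Z'"
    using q q' by (simp_all add: quotient_map_def)
  then have "homeomorphic_maps Z Z' h k"
    using h k unfolding homeomorphic_maps_def by (metis (no_types, lifting) imageE)
  then show ?thesis
    using h homeomorphic_map_maps by blast
qed

section \<open>Minimal actions of an abelian group\<close>

locale minimal_flow =
  fixes X :: "'a topology" and act :: "'g::topological_ab_group_add \<Rightarrow> 'a \<Rightarrow> 'a"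
  assumes minimal: "minimal_G_system X act"
begin

lemma compact: "compact_space X" and Hausdorff: "Hausdorff_space X"
  and act_zero [simp]: "\<And>x. x \<in> topspace X \<Longrightarrow> act 0 x = x"
  and act_add: "\<And>g h x. x \<in> topspace X \<Longrightarrow> act (g + h) x = act g (act h x)"
  and continuous_action: "continuous_map (prod_topology euclidean X) X (\<lambda>(g, x). act g x)"
  using minimal by (auto simp: minimal_G_system_def G_system_def)

lemma continuous_act: "continuous_map X X (act g)"
proof -
  have "continuous_map X (prod_topology euclidean X) (\<lambda>x. (g, x))"
    by (simp add: continuous_map_pairwise o_def)
  from continuous_map_compose[OF this continuous_action] show ?thesis
    by (simp add: o_def)
qed

lemma act_closed [simp]: "x \<in> topspace X \<Longrightarrow> act g x \<in> topspace X"
  using continuous_act continuous_map_image_subset_topspace by fastforce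

lemma act_minus [simp]: "x \<in> topspace X \<Longrightarrow> act (- g) (act g x) = x"
  "x \<in> topspace X \<Longrightarrow> act g (act (- g) x) = x"
  by (metis act_add act_zero add.left_inverse) (metis act_add act_zero add.right_inverse)

lemma act_commute: "x \<in> topspace X \<Longrightarrow> act g (act h x) = act h (act g x)"
  by (metis act_add add.commute)

definition pre :: "'g \<Rightarrow> 'a set \<Rightarrow> 'a set" where
  "pre g U = {x \<in> topspace X. act g x \<in> U}"

lemma openin_pre: "openin X U \<Longrightarrow> openin X (pre g U)"
  unfolding pre_def using continuous_act openin_continuous_map_preimage by blast

lemma orbit_meets_open:
  assumes "x \<in> topspace X" "openin X U" "U \<noteq> {}"
  shows "\<exists>g. act g x \<in> U"
proof -
  have "X closure_of (orbit act x) = topspace X"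
    using minimal assms(1) by (simp add: minimal_G_system_def)
  moreover obtain u where "u \<in> U" "u \<in> topspace X"
    using assms openin_subset by blast
  ultimately show ?thesis
    using assms(2) in_closure_of[of u X "orbit act x"] by (auto simp: orbit_def)
qed

lemma pre_meets_open:
  assumes "openin X U" "U \<noteq> {}" "openin X V" "V \<noteq> {}"
  shows "\<exists>g. U \<inter> pre g V \<noteq> {}"
proof -
  obtain x where "x \<in> U" "x \<in> topspace X"
    using assms openin_subset by blast
  then show ?thesis
    using orbit_meets_open[of x V] assms by (auto simp: pre_def)
qed

section \<open>Return times and regional proximality\<close>

text \<open>In particular, \<open>meets g O' O'\<close> says that \<open>g\<close> is a return time
  of \<open>O'\<close>.\<close>

definition meets :: "'g \<Rightarrow> 'a set \<Rightarrow> 'a set \<Rightarrow> bool" where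
  "meets g A B \<longleftrightarrow> (\<exists>x\<in>A. act g x \<in> B)"

lemma meetsI: "x \<in> A \<Longrightarrow> act g x \<in> B \<Longrightarrow> meets g A B"
  unfolding meets_def by blast

text \<open>The return-time sets of nonempty open sets form a filter base: translating by \<open>t\<close> does not
  change return times because the group is commutative.\<close>

lemma return_times_filter_base:
  assumes "finite \<O>" "\<And>A. A \<in> \<O> \<Longrightarrow> openin X A \<and> A \<noteq> {}" "topspace X \<noteq> {}"
  shows "\<exists>O'. openin X O' \<and> O' \<noteq> {} \<and> (\<forall>g. meets g O' O' \<longrightarrow> (\<forall>A\<in>\<O>. meets g A A))"
  using assms(1,2)
proof (induction \<O> rule: finite_induct)
  case empty
  then show ?case using assms(3) by auto
next
  case (insert A \<O>)
  then obtain P where P: "openin X P" "P \<noteq> {}"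
      "\<And>g B. meets g P P \<Longrightarrow> B \<in> \<O> \<Longrightarrow> meets g B B"
    by auto
  have A: "openin X A" "A \<noteq> {}"
    using insert.prems by auto
  obtain t where t: "P \<inter> pre t A \<noteq> {}"
    using pre_meets_open[OF P(1,2) A] by blast
  have "meets g P P \<and> meets g A A" if "meets g (P \<inter> pre t A) (P \<inter> pre t A)" for g
  proof -
    obtain x where x: "x \<in> P" "x \<in> topspace X" "act t x \<in> A" "act g x \<in> P" "act t (act g x) \<in> A"
      using \<open>meets g _ _\<close> by (auto simp: meets_def pre_def)
    then show ?thesis
      using act_commute[of x g t] meetsI[of x P g P] meetsI[of "act t x" A g A] by simp
  qed
  then have "\<forall>g. meets g (P \<inter> pre t A) (P \<inter> pre t A) \<longrightarrow> (\<forall>B\<in>insert A \<O>. meets g B B)"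
    using P(3) by (metis insert_iff)
  moreover have "openin X (P \<inter> pre t A)"
    using P A openin_pre by blast
  ultimately show ?case
    using t by meson
qed

text \<open>In this setting \<open>rp\<close> is the regionally proximal relation; the formulation by return times
  makes it visibly closed and fits the construction of independence sets.\<close>

definition rp :: "'a \<Rightarrow> 'a \<Rightarrow> bool" where
  "rp a b \<longleftrightarrow> (\<forall>A B O'. openin X A \<and> a \<in> A \<and> openin X B \<and> b \<in> B \<and> openin X O' \<and> O' \<noteq> {} \<longrightarrow>
     (\<exists>s. meets s O' O' \<and> meets s A B))"

text \<open>By commutativity, if \<open>s\<close> brings points of \<open>A\<close> and \<open>B\<close> into \<open>O'\<close> and
  \<open>t\<close> moves the one point close to the other, then \<open>t\<close> is a return time of \<open>O'\<close>.\<close>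

lemma not_rp_separation:
  assumes "\<not> rp a b"
  shows "\<exists>A B O'. openin X A \<and> a \<in> A \<and> openin X B \<and> b \<in> B \<and> openin X O' \<and> O' \<noteq> {} \<and>
    (\<forall>s x y. x \<in> A \<longrightarrow> y \<in> B \<longrightarrow> \<not> (act s x \<in> O' \<and> act s y \<in> O'))"
proof -
  obtain A B O' where *: "openin X A" "a \<in> A" "openin X B" "b \<in> B" "openin X O'" "O' \<noteq> {}"
    and no: "\<And>s. meets s O' O' \<Longrightarrow> \<not> meets s A B"
    using assms unfolding rp_def by blast
  have False if xy: "x \<in> A" "y \<in> B" "act s x \<in> O'" "act s y \<in> O'" for s x y
  proof -
    have "x \<in> topspace X" "y \<in> topspace X"
      using xy * openin_subset by blast+
    then have "x \<in> A \<inter> pre s O'" "y \<in> B \<inter> pre s O'"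
      using xy by (auto simp: pre_def)
    moreover have "openin X (A \<inter> pre s O')" "openin X (B \<inter> pre s O')"
      using * openin_pre by blast+
    ultimately obtain t where "(A \<inter> pre s O') \<inter> pre t (B \<inter> pre s O') \<noteq> {}"
      using pre_meets_open by (metis empty_iff)
    then obtain z where "z \<in> A" "z \<in> topspace X" "act s z \<in> O'" "act t z \<in> B" "act s (act t z) \<in> O'"
      by (auto simp: pre_def)
    then have "meets t O' O'" "meets t A B"
      using act_commute[of z s t] meetsI[of "act s z" O' t O'] meetsI[of z A t B] by simp_all
    then show False
      using no by blast
  qed
  then show ?thesis
    using * by blast
qed

section \<open>Construction of independence sets\<close>

text \<open>The sets in \<open>\<W>\<close> will be the cells of a finite independence pattern; one
  \<open>r\<close> carrying each cell both to \<open>U\<close> and to \<open>V\<close> splits them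
  all at once, whereas \<open>H\<close> treats one open set at a time.\<close>

lemma simultaneous_meeting:
  assumes U: "openin X U" "U \<noteq> {}" and V: "openin X V"
    and H: "\<And>P Q. openin X P \<Longrightarrow> P \<noteq> {} \<Longrightarrow> P \<subseteq> U \<Longrightarrow> openin X Q \<Longrightarrow> Q \<noteq> {} \<Longrightarrow>
      \<exists>s. meets s Q Q \<and> meets s P V"
    and fin: "finite \<W>" and \<W>: "\<And>W. W \<in> \<W> \<Longrightarrow> openin X W \<and> W \<noteq> {} \<and> W \<subseteq> U"
  shows "\<exists>r. \<forall>W\<in>\<W>. meets r W U \<and> meets r W V"
proof -
  have ne: "topspace X \<noteq> {}"
    using U openin_subset by blast
  text \<open>Elements of \<open>\<W>\<close> are brought to \<open>V\<close> one at a time; a return time of all the sets already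
    positioned does not spoil what has been achieved.\<close>
  have "\<exists>r. \<forall>W\<in>\<W>. meets r W U \<and> (W \<in> \<V> \<longrightarrow> meets r W V)" if "finite \<V>" "\<V> \<subseteq> \<W>" for \<V>
    using that
  proof (induction \<V> rule: finite_induct)
    case empty
    have "meets 0 W U" if "W \<in> \<W>" for W
    proof -
      obtain x where "x \<in> W" "x \<in> U" "x \<in> topspace X"
        using \<W>[of W] \<open>W \<in> \<W>\<close> openin_subset by blast
      then show ?thesis
        using meetsI[of x W 0 U] by simp
    qed
    then show ?case by blast
  next
    case (insert B \<V>)
    then obtain r where r: "\<And>W. W \<in> \<W> \<Longrightarrow> meets r W U" "\<And>W. W \<in> \<V> \<Longrightarrow> meets r W V"
      by (metis insert_subset subsetD)
    \<comment> \<open>The pieces that \<open>r\<close> already carries into their targets; a common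
      return time \<open>s\<close> of these pieces preserves every such meeting for
      \<open>r + s\<close>.\<close>
    define \<O> where "\<O> = (\<lambda>W. W \<inter> pre r U) ` \<W> \<union> (\<lambda>W. W \<inter> pre r V) ` \<V>"
    have sub: "\<V> \<subseteq> \<W>" "B \<in> \<W>"
      using insert.prems by auto
    have mp: "W \<inter> pre r S \<noteq> {}" if "W \<in> \<W>" "meets r W S" for W S
    proof -
      have "W \<subseteq> topspace X"
        using \<W>[OF \<open>W \<in> \<W>\<close>] openin_subset by blast
      then show ?thesis
        using that(2) by (auto simp: meets_def pre_def)
    qed
    have op: "openin X (W \<inter> pre r S)" if "W \<in> \<W>" "openin X S" for W S
      using that \<W> openin_pre by blast
    have "\<And>A. A \<in> \<O> \<Longrightarrow> openin X A \<and> A \<noteq> {}" "finite \<O>"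
      unfolding \<O>_def using mp op r sub U V fin insert.hyps(1) by auto
    then obtain Q where Q: "openin X Q" "Q \<noteq> {}" "\<And>g A. meets g Q Q \<Longrightarrow> A \<in> \<O> \<Longrightarrow> meets g A A"
      using return_times_filter_base[of \<O>] ne by blast
    \<comment> \<open>The part of \<open>B\<close> translated by \<open>r\<close> that lies in
      \<open>U\<close>, so that \<open>H\<close> can carry it to \<open>V\<close>. It is nonempty
      because the induction keeps every set, treated or not, meeting \<open>U\<close>.\<close>
    define P where "P = pre (- r) B \<inter> U"
    have B: "openin X B" "B \<subseteq> topspace X"
      using \<W>[OF sub(2)] openin_subset by blast+
    obtain b where b: "b \<in> B" "act r b \<in> U"
      using r(1)[OF sub(2)] by (auto simp: meets_def)
    have "b \<in> topspace X"
      using b(1) B by blast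
    then have "act r b \<in> P"
      using b by (auto simp: P_def pre_def)
    moreover have "openin X P"
      using B U openin_pre P_def by blast
    ultimately obtain s where s: "meets s Q Q" "meets s P V"
      using H[of P Q] Q P_def by blast
    have keep: "meets (r + s) W S" if "W \<inter> pre r S \<in> \<O>" for W S
    proof -
      obtain x where "x \<in> W" "x \<in> topspace X" "act r (act s x) \<in> S"
        using Q(3)[OF s(1) \<open>W \<inter> pre r S \<in> \<O>\<close>] by (auto simp: meets_def pre_def)
      then show ?thesis
        using meetsI[of x W "r + s" S] act_add by simp
    qed
    \<comment> \<open>By commutativity, applying \<open>r + s\<close> to the point
      \<open>act (- r) x\<close> of \<open>B\<close> leaves only the motion \<open>s\<close>, which
      leads to \<open>V\<close>.\<close>
    have "meets (r + s) B V"
    proof -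
      obtain x where "x \<in> topspace X" "act (- r) x \<in> B" "act s x \<in> V"
        using s(2) by (auto simp: P_def meets_def pre_def)
      moreover from this have "act (r + s) (act (- r) x) = act s x"
        by (simp add: act_add[symmetric])
      ultimately show ?thesis
        using meetsI[of "act (- r) x" B "r + s" V] by simp
    qed
    moreover have "meets (r + s) W U" if "W \<in> \<W>" for W
      using keep[of W U] that by (simp add: \<O>_def)
    moreover have "meets (r + s) W V" if "W \<in> \<V>" for W
      using keep[of W V] that by (simp add: \<O>_def)
    ultimately show ?case by blast
  qed
  from this[OF fin subset_refl] show ?thesis by blast
qed

text \<open>Finite independent sets are extended one element at a time,
  \<open>simultaneous_meeting\<close> splitting all cells of the present set. \<open>H\<close> is
  available on the smaller \<open>U\<close> only; independence for \<open>(U, V)\<close> gives that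
  for \<open>(U0, V)\<close>.\<close>

lemma infinite_independence_set:
  assumes U: "openin X U" "U \<noteq> {}" "U \<subseteq> U0" and V: "openin X V" and disj: "U0 \<inter> V = {}"
    and H: "\<And>P Q. openin X P \<Longrightarrow> P \<noteq> {} \<Longrightarrow> P \<subseteq> U \<Longrightarrow> openin X Q \<Longrightarrow> Q \<noteq> {} \<Longrightarrow>
      \<exists>s. meets s Q Q \<and> meets s P V"
  shows "\<exists>J. infinite J \<and> independence_set X act U0 V J"
proof -
  \<comment> \<open>A cell: elements of \<open>F\<close> in \<open>T\<close> send the point to
    \<open>U\<close>, the others send it to \<open>V\<close>. The point itself is kept in
    \<open>U\<close> so that \<open>simultaneous_meeting\<close> applies to cells.\<close>
  define W where "W F T = {x \<in> U. \<forall>s\<in>F. act s x \<in> (if s \<in> T then U else V)}" for F T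
  define good where "good F \<longleftrightarrow> (\<forall>T. W F T \<noteq> {})" for F
  have "\<exists>J. infinite J \<and> (\<forall>I. finite I \<and> I \<subseteq> J \<longrightarrow> good I)"
  proof (rule infinite_set_by_finite_extension)
    show "good {}"
      using U by (simp add: good_def W_def)
    show "good F'" if "good F" "F' \<subseteq> F" for F F'
      using that unfolding good_def W_def by blast
    show "\<exists>s. s \<notin> F \<and> good (insert s F)" if F: "finite F" "good F" for F
    proof -
      have op: "openin X (W F T)" for T
        using F(1)
      proof (induction F rule: finite_induct)
        case empty
        then show ?case using U by (simp add: W_def)
      next
        case (insert s F)
        have "W (insert s F) T = W F T \<inter> pre s (if s \<in> T then U else V)"
          using U(1) openin_subset by (auto simp: W_def pre_def)
        then show ?case
          using insert U V openin_pre by auto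
      qed
      \<comment> \<open>Thus finitely many cells, indexed by the subsets of \<open>F\<close>,
        represent all patterns.\<close>
      have cut: "W F T = W F (T \<inter> F)" for T
        by (auto simp: W_def)
      obtain r where r: "\<And>T. T \<subseteq> F \<Longrightarrow> meets r (W F T) U \<and> meets r (W F T) V"
      proof -
        have "W F T \<subseteq> U" for T
          by (auto simp: W_def)
        then have "\<exists>r. \<forall>A\<in>W F ` Pow F. meets r A U \<and> meets r A V"
          using F op by (intro simultaneous_meeting[OF U(1,2) V H]) (auto simp: good_def)
        then show ?thesis
          using that by blast
      qed
      \<comment> \<open>An element of \<open>F\<close> carries the cell \<open>W F F\<close> into
        \<open>U\<close>, hence off \<open>V\<close>, whereas \<open>r\<close> makes this cell meet
        \<open>V\<close>.\<close>
      have "r \<notin> F"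
      proof
        assume "r \<in> F"
        then have "\<not> meets r (W F F) V"
          using disj U(3) by (auto simp: meets_def W_def)
        then show False
          using r by blast
      qed
      moreover have "W (insert r F) T \<noteq> {}" for T
      proof -
        have "meets r (W F T) (if r \<in> T then U else V)"
          using r[of "T \<inter> F"] cut by simp
        then obtain x where "x \<in> W F T" "act r x \<in> (if r \<in> T then U else V)"
          by (auto simp: meets_def)
        then have "x \<in> W (insert r F) T"
          unfolding W_def by simp
        then show ?thesis
          by blast
      qed
      ultimately show ?thesis
        by (auto simp: good_def)
    qed
  qed
  then obtain J where J: "infinite J" "\<And>I. finite I \<Longrightarrow> I \<subseteq> J \<Longrightarrow> good I"
    by blast
  have "independence_set X act U0 V J"
    unfolding independence_set_def
  proof (intro allI impI)
    fix I and \<sigma> :: "'g \<Rightarrow> bool"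
    assume I: "finite I \<and> I \<noteq> {} \<and> I \<subseteq> J"
    then obtain x where "x \<in> W I {s. \<sigma> s}"
      using J(2)[of I] by (auto simp: good_def)
    then have "x \<in> (\<Inter>s\<in>I. {x \<in> topspace X. act s x \<in> (if \<sigma> s then U0 else V)})"
      using U openin_subset[OF U(1)] by (auto simp: W_def split: if_splits)
    then show "(\<Inter>s\<in>I. {x \<in> topspace X. act s x \<in> (if \<sigma> s then U0 else V)}) \<noteq> {}"
      by blast
  qed
  then show ?thesis
    using J(1) by blast
qed

lemma independence_set_mono:
  assumes "independence_set X act U V J" "U \<subseteq> U'" "V \<subseteq> V'"
  shows "independence_set X act U' V' J"
proof -
  have "(if b then U else V) \<subseteq> (if b then U' else V')" for b
    using assms(2,3) by simp
  then have mono: "(\<Inter>s\<in>I. {x \<in> topspace X. act s x \<in> (if \<sigma> s then U else V)})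
      \<subseteq> (\<Inter>s\<in>I. {x \<in> topspace X. act s x \<in> (if \<sigma> s then U' else V')})" for I and \<sigma> :: "'g \<Rightarrow> bool"
    by (intro INF_mono) blast
  show ?thesis
    unfolding independence_set_def
  proof (intro allI impI)
    fix I :: "'g set" and \<sigma> :: "'g \<Rightarrow> bool"
    assume "finite I \<and> I \<noteq> {} \<and> I \<subseteq> J"
    then have "(\<Inter>s\<in>I. {x \<in> topspace X. act s x \<in> (if \<sigma> s then U else V)}) \<noteq> {}"
      by (rule assms(1)[unfolded independence_set_def, rule_format])
    then obtain x where "x \<in> (\<Inter>s\<in>I. {x \<in> topspace X. act s x \<in> (if \<sigma> s then U else V)})"
      by (auto simp only: ex_in_conv[symmetric])
    then have "x \<in> (\<Inter>s\<in>I. {x \<in> topspace X. act s x \<in> (if \<sigma> s then U' else V')})"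
      by (rule subsetD[OF mono])
    then show "(\<Inter>s\<in>I. {x \<in> topspace X. act s x \<in> (if \<sigma> s then U' else V')}) \<noteq> {}"
      by (simp only: ex_in_conv[symmetric]) (rule exI)
  qed
qed

section \<open>Open rectangles generically free of regionally proximal pairs\<close>

text \<open>In other words, the points of \<open>U\<close> with a neighbourhood unrelated to
  \<open>V\<close> are dense in \<open>U\<close>. The two sides are packed as one pair so that
  rectangles can index an open cover.\<close>

definition sparse_pair :: "'a set \<times> 'a set \<Rightarrow> bool" where
  "sparse_pair = (\<lambda>(U, V). openin X U \<and> openin X V \<and>
     (\<forall>U'. openin X U' \<and> U' \<noteq> {} \<and> U' \<subseteq> U \<longrightarrow>
       (\<exists>U''. openin X U'' \<and> U'' \<noteq> {} \<and> U'' \<subseteq> U' \<and> (\<forall>a\<in>U''. \<forall>b\<in>V. \<not> rp a b))))"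

text \<open>Shrink to disjoint neighbourhoods without infinite independence sets. On any smaller
  open \<open>U'\<close> the hypothesis \<open>H\<close> of \<open>infinite_independence_set\<close>
  must fail; its failure supplies \<open>P\<close> and \<open>Q\<close>, and \<open>Q\<close>
  witnesses that no point of \<open>P\<close> is related to a point of \<open>V\<close>.\<close>

lemma not_IT2_sparse_pair:
  assumes xy: "x \<in> topspace X" "y \<in> topspace X" "x \<noteq> y" and not_IT2: "(x, y) \<notin> IT2 X act"
  shows "\<exists>U V. x \<in> U \<and> y \<in> V \<and> sparse_pair (U, V)"
proof -
  obtain U1 V1 where 1: "openin X U1" "x \<in> U1" "openin X V1" "y \<in> V1"
      "\<And>J. infinite J \<Longrightarrow> \<not> independence_set X act U1 V1 J"
    using xy not_IT2 unfolding IT2_def by blast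
  obtain U2 V2 where 2: "openin X U2" "openin X V2" "x \<in> U2" "y \<in> V2" "disjnt U2 V2"
    using Hausdorff xy unfolding Hausdorff_space_def by blast
  define U V where "U = U1 \<inter> U2" and "V = V1 \<inter> V2"
  have UV: "openin X U" "openin X V" "x \<in> U" "y \<in> V" "U \<inter> V = {}"
    using 1 2 by (auto simp: U_def V_def disjnt_iff)
  have no_indep: "\<not> independence_set X act U V J" if "infinite J" for J
    using 1(5)[OF that] independence_set_mono[of U V J U1 V1] by (auto simp: U_def V_def)
  have "\<exists>P. openin X P \<and> P \<noteq> {} \<and> P \<subseteq> U' \<and> (\<forall>a\<in>P. \<forall>b\<in>V. \<not> rp a b)"
    if U': "openin X U'" "U' \<noteq> {}" "U' \<subseteq> U" for U'
  proof -
    obtain P Q where PQ: "openin X P" "P \<noteq> {}" "P \<subseteq> U'" "openin X Q" "Q \<noteq> {}"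
        "\<And>s. meets s Q Q \<Longrightarrow> \<not> meets s P V"
      using infinite_independence_set[OF U' UV(2,5)] no_indep by blast
    then have "\<not> rp a b" if "a \<in> P" "b \<in> V" for a b
      using that UV(2) unfolding rp_def by blast
    then show ?thesis
      using PQ by blast
  qed
  then show ?thesis
    using UV unfolding sparse_pair_def by (intro exI[of _ U] exI[of _ V]) simp
qed

text \<open>Shrink for one rectangle at a time; what has been avoided stays avoided on smaller sets,
  and a rectangle whose first side is missed demands nothing.\<close>

lemma avoid_finitely_many_sparse_pairs:
  assumes "finite \<R>" "\<And>R. R \<in> \<R> \<Longrightarrow> sparse_pair R" "openin X W" "W \<noteq> {}"
  shows "\<exists>W'. openin X W' \<and> W' \<noteq> {} \<and> W' \<subseteq> W \<and>
    (\<forall>(U, V)\<in>\<R>. \<forall>a\<in>W' \<inter> U. \<forall>b\<in>V. \<not> rp a b)"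
  using assms(1,2)
proof (induction \<R> rule: finite_induct)
  case empty
  then show ?case using assms by auto
next
  case (insert R \<R>)
  obtain U V where R: "R = (U, V)"
    by (cases R)
  obtain W' where W': "openin X W'" "W' \<noteq> {}" "W' \<subseteq> W"
      "\<And>U V a b. (U, V) \<in> \<R> \<Longrightarrow> a \<in> W' \<Longrightarrow> a \<in> U \<Longrightarrow> b \<in> V \<Longrightarrow> \<not> rp a b"
    using insert by fastforce
  show ?case
  proof (cases "W' \<inter> U = {}")
    case True
    then show ?thesis
      using W' R by (intro exI[of _ W']) auto
  next
    case False
    have "sparse_pair (U, V)"
      using insert.prems R by simp
    moreover from this have "openin X (W' \<inter> U)"
      using W' by (auto simp: sparse_pair_def)
    ultimately obtain W'' where "openin X W''" "W'' \<noteq> {}" "W'' \<subseteq> W' \<inter> U"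
        "\<And>a b. a \<in> W'' \<Longrightarrow> b \<in> V \<Longrightarrow> \<not> rp a b"
      using False unfolding sparse_pair_def
      by (smt (verit, best) case_prod_conv inf.cobounded2)
    then show ?thesis
      using W' R by (intro exI[of _ W'']) auto
  qed
qed

section \<open>Proximal pairs\<close>

text \<open>Proximality in a form suited to minimal systems: the target is an arbitrary open set
  instead of the neighbourhoods of one limit point. \<open>prox_iff_orbit_closure_meets_diag\<close>
  relates it to the usual notion.\<close>

definition prox :: "'a \<Rightarrow> 'a \<Rightarrow> bool" where
  "prox x y \<longleftrightarrow> (\<forall>U. openin X U \<and> U \<noteq> {} \<longrightarrow> (\<exists>g. act g x \<in> U \<and> act g y \<in> U))"

lemma prox_imp_rp: "prox x y \<Longrightarrow> rp x y"
  using not_rp_separation[of x y] unfolding prox_def by blast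

lemma prox_act:
  assumes "prox x y" "x \<in> topspace X" "y \<in> topspace X"
  shows "prox (act h x) (act h y)"
  unfolding prox_def
proof (intro allI impI)
  fix U assume "openin X U \<and> U \<noteq> {}"
  then obtain g where "act g x \<in> U" "act g y \<in> U"
    using assms(1) unfolding prox_def by blast
  then show "\<exists>g. act g (act h x) \<in> U \<and> act g (act h y) \<in> U"
    using assms by (intro exI[of _ "g - h"]) (simp flip: act_add)
qed

text \<open>Forwards, each neighbourhood of \<open>(x, x)\<close> contains the square of a nonempty
  open set, which the pair enters. Backwards, minimality carries the limit point \<open>w\<close>
  into \<open>U\<close> by some \<open>h\<close>, and the pair enters the square of
  \<open>pre h U\<close>.\<close>

lemma prox_iff_orbit_closure_meets_diag:
  assumes xy: "x \<in> topspace X" "y \<in> topspace X"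
  shows "prox x y \<longleftrightarrow>
    (prod_topology X X) closure_of (range (\<lambda>g. (act g x, act g y))) \<inter> diag X \<noteq> {}"
proof
  assume prox: "prox x y"
  have "(x, x) \<in> (prod_topology X X) closure_of (range (\<lambda>g. (act g x, act g y)))"
    unfolding in_closure_of
  proof (intro conjI allI impI)
    show "(x, x) \<in> topspace (prod_topology X X)"
      using xy by simp
    fix T assume "(x, x) \<in> T \<and> openin (prod_topology X X) T"
    then obtain A B where AB: "openin X A" "openin X B" "x \<in> A" "x \<in> B" "A \<times> B \<subseteq> T"
      by (metis openin_prod_topology_alt)
    then have "openin X (A \<inter> B)" "A \<inter> B \<noteq> {}"
      by auto
    then obtain g where "act g x \<in> A \<inter> B" "act g y \<in> A \<inter> B"
      using prox unfolding prox_def by blast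
    then show "\<exists>z. z \<in> range (\<lambda>g. (act g x, act g y)) \<and> z \<in> T"
      using AB(5) by blast
  qed
  then show "(prod_topology X X) closure_of (range (\<lambda>g. (act g x, act g y))) \<inter> diag X \<noteq> {}"
    using xy by (auto simp: diag_def)
next
  assume "(prod_topology X X) closure_of (range (\<lambda>g. (act g x, act g y))) \<inter> diag X \<noteq> {}"
  then obtain w where w: "w \<in> topspace X"
      "(w, w) \<in> (prod_topology X X) closure_of (range (\<lambda>g. (act g x, act g y)))"
    by (auto simp: diag_def)
  show "prox x y"
    unfolding prox_def
  proof (intro allI impI)
    fix U assume U: "openin X U \<and> U \<noteq> {}"
    then obtain h where h: "act h w \<in> U"
      using orbit_meets_open w by blast
    have "openin (prod_topology X X) (pre h U \<times> pre h U)"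
      using U openin_pre by (simp add: openin_prod_Times_iff)
    moreover have "(w, w) \<in> pre h U \<times> pre h U"
      using w h by (simp add: pre_def)
    ultimately obtain z where "z \<in> range (\<lambda>g. (act g x, act g y))" "z \<in> pre h U \<times> pre h U"
      using w(2) unfolding in_closure_of by meson
    then obtain g where "(act g x, act g y) \<in> pre h U \<times> pre h U"
      by blast
    then show "\<exists>g. act g x \<in> U \<and> act g y \<in> U"
      using xy by (intro exI[of _ "h + g"]) (simp add: pre_def act_add)
  qed
qed

lemma proximal_ext_iff: "proximal_ext X act q \<longleftrightarrow> (\<forall>(x, y)\<in>Rel X q. prox x y)"
  unfolding proximal_ext_def
proof (intro ball_cong refl)
  fix z assume "z \<in> Rel X q"
  then obtain x y where "z = (x, y)" "x \<in> topspace X" "y \<in> topspace X"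
    by (auto simp: Rel_def)
  then show "(case z of (x1, x2) \<Rightarrow>
      (prod_topology X X) closure_of (range (\<lambda>g. (act g x1, act g x2))) \<inter> diag X \<noteq> {}) =
    (case z of (x, y) \<Rightarrow> prox x y)"
    by (simp only: case_prod_conv prox_iff_orbit_closure_meets_diag)
qed

end

section \<open>The proximal relation of a tame extension\<close>

locale tame_extension = minimal_flow X actX
  for X :: "'a topology" and actX :: "'g::topological_ab_group_add \<Rightarrow> 'a \<Rightarrow> 'a" +
  fixes Y :: "'b topology" and actY :: "'g \<Rightarrow> 'b \<Rightarrow> 'b" and p :: "'a \<Rightarrow> 'b"
  assumes HausdorffY: "Hausdorff_space Y" and ext: "extension X actX Y actY p"
    and tame: "tame_ext X actX p"
begin

lemma continuous_p: "continuous_map X Y p" and surj_p: "p ` topspace X = topspace Y"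
  and equivariant_p: "\<And>g x. x \<in> topspace X \<Longrightarrow> p (actX g x) = actY g (p x)"
  using ext by (auto simp: extension_def)

lemma Rel_act: "(x, y) \<in> Rel X p \<Longrightarrow> (actX g x, actX g y) \<in> Rel X p"
  by (auto simp: Rel_def equivariant_p)

text \<open>Tameness enters here: sparse rectangles cover the compact set of fibre pairs leading
  from a closed \<open>C\<close> inside \<open>U\<close> to the outside of \<open>U\<close>.
  Finitely many suffice, and some nonempty open subset of \<open>C\<close> avoids them all.\<close>

lemma small_fibres:
  assumes U: "openin X U" "U \<noteq> {}"
  shows "\<exists>W. openin X W \<and> W \<noteq> {} \<and> W \<subseteq> U \<and>
    (\<forall>x y. (x, y) \<in> Rel X p \<longrightarrow> rp x y \<longrightarrow> x \<in> W \<longrightarrow> y \<in> U)"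
proof -
  obtain x0 where "x0 \<in> U"
    using U by blast
  moreover have "neighbourhood_base_of (closedin X) X"
    using compact Hausdorff compact_Hausdorff_imp_regular_space neighbourhood_base_of_closedin
    by blast
  ultimately obtain U1 C where U1: "openin X U1" "closedin X C" "x0 \<in> U1" "U1 \<subseteq> C" "C \<subseteq> U"
    using U(1) unfolding neighbourhood_base_of by meson
  \<comment> \<open>The pairs to be excluded. Taking \<open>C\<close> closed makes \<open>K\<close>
    compact, and \<open>C \<subseteq> U\<close> keeps \<open>K\<close> off the diagonal.\<close>
  define K where "K = Rel X p \<inter> C \<times> (topspace X - U)"
  have "closedin (prod_topology X X) K"
    unfolding K_def using U U1 closedin_Rel[OF HausdorffY continuous_p]
    by (intro closedin_Int) (auto simp: closedin_prod_Times_iff)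
  then have "compactin (prod_topology X X) K"
    using compact closedin_compact_space compact_space_prod_topology by blast
  moreover have "\<exists>R\<in>Collect sparse_pair. z \<in> fst R \<times> snd R" if "z \<in> K" for z
  proof -
    obtain x y where z: "z = (x, y)" "(x, y) \<in> Rel X p" "x \<in> C" "y \<notin> U"
      using \<open>z \<in> K\<close> unfolding K_def by (cases z) auto
    then have "x \<in> topspace X" "y \<in> topspace X" "x \<noteq> y"
      using U1 by (auto simp: Rel_def)
    moreover from this have "(x, y) \<notin> IT2 X actX"
      using tame z by (auto simp: tame_ext_def diag_def)
    ultimately obtain A B where "x \<in> A" "y \<in> B" "sparse_pair (A, B)"
      using not_IT2_sparse_pair[of x y] by auto
    then show ?thesis
      using z by force
  qed
  then have "K \<subseteq> \<Union> ((\<lambda>R. fst R \<times> snd R) ` Collect sparse_pair)"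
    by blast
  moreover have "openin (prod_topology X X) (fst R \<times> snd R)"
    if "R \<in> Collect sparse_pair" for R
    using that by (auto simp: sparse_pair_def openin_prod_Times_iff)
  ultimately obtain \<R> where "finite \<R>" "\<R> \<subseteq> Collect sparse_pair"
      "K \<subseteq> (\<Union>R\<in>\<R>. fst R \<times> snd R)"
    by (rule compactin_finite_subfamily)
  then have \<R>: "finite \<R>" "\<And>R. R \<in> \<R> \<Longrightarrow> sparse_pair R" "K \<subseteq> (\<Union>R\<in>\<R>. fst R \<times> snd R)"
    by auto
  obtain W where W: "openin X W" "W \<noteq> {}" "W \<subseteq> U1"
      "\<forall>(A, B)\<in>\<R>. \<forall>a\<in>W \<inter> A. \<forall>b\<in>B. \<not> rp a b"
    using avoid_finitely_many_sparse_pairs[OF \<R>(1,2) U1(1)] U1(3) by blast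
  have "y \<in> U" if xy: "(x, y) \<in> Rel X p" "rp x y" "x \<in> W" for x y
  proof (rule ccontr)
    assume "y \<notin> U"
    then have "(x, y) \<in> K"
      using xy W(3) U1(4) by (auto simp: K_def Rel_def)
    then obtain A B where "(A, B) \<in> \<R>" "x \<in> A" "y \<in> B"
      using \<R>(3) by fastforce
    then show False
      using W(4) xy by blast
  qed
  moreover have "W \<subseteq> U"
    using W(3) U1 by simp
  ultimately show ?thesis
    using W(1,2) by (intro exI[of _ W]) simp
qed

lemma rp_act:
  assumes "rp x y" "x \<in> topspace X" "y \<in> topspace X"
  shows "rp (actX g x) (actX g y)"
  unfolding rp_def
proof (intro allI impI)
  fix A B O'
  assume H: "openin X A \<and> actX g x \<in> A \<and> openin X B \<and> actX g y \<in> B \<and> openin X O' \<and> O' \<noteq> {}"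
  then have "openin X (pre g A)" "x \<in> pre g A" "openin X (pre g B)" "y \<in> pre g B"
    using assms openin_pre by (auto simp: pre_def)
  then obtain s where s: "meets s O' O'" "meets s (pre g A) (pre g B)"
    using assms(1) H unfolding rp_def by blast
  then obtain z where z: "z \<in> topspace X" "actX g z \<in> A" "actX g (actX s z) \<in> B"
    by (auto simp: meets_def pre_def)
  then have "meets s A B"
    using act_commute[of z g s] meetsI[of "actX g z" A s B] by simp
  then show "\<exists>s. meets s O' O' \<and> meets s A B"
    using s by blast
qed

text \<open>Forwards, minimality carries \<open>x\<close> into the \<open>W\<close> of
  \<open>small_fibres\<close>; \<open>y\<close>, moved along and still related, is forced into
  \<open>U\<close>.\<close>

lemma rp_iff_prox:
  assumes xy: "(x, y) \<in> Rel X p"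
  shows "rp x y \<longleftrightarrow> prox x y"
proof
  assume rp: "rp x y"
  have top: "x \<in> topspace X" "y \<in> topspace X"
    using xy by (auto simp: Rel_def)
  show "prox x y"
    unfolding prox_def
  proof (intro allI impI)
    fix U assume "openin X U \<and> U \<noteq> {}"
    then obtain W where W: "openin X W" "W \<noteq> {}" "W \<subseteq> U"
        "\<And>x y. (x, y) \<in> Rel X p \<Longrightarrow> rp x y \<Longrightarrow> x \<in> W \<Longrightarrow> y \<in> U"
      using small_fibres[of U] by auto
    obtain g where g: "actX g x \<in> W"
      using orbit_meets_open[OF top(1) W(1,2)] ..
    then have "actX g y \<in> U"
      by (rule W(4)[OF Rel_act[OF xy] rp_act[OF rp top]])
    then show "\<exists>g. actX g x \<in> U \<and> actX g y \<in> U"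
      using g W(3) by auto
  qed
qed (rule prox_imp_rp)

definition PR :: "('a \<times> 'a) set" where
  "PR = {(x, y) \<in> Rel X p. prox x y}"

lemma PR_small_fibres:
  assumes "openin X U" "U \<noteq> {}"
  shows "\<exists>W. openin X W \<and> W \<noteq> {} \<and> W \<subseteq> U \<and> (\<forall>x y. (x, y) \<in> PR \<longrightarrow> x \<in> W \<longrightarrow> y \<in> U)"
proof -
  obtain W where W: "openin X W" "W \<noteq> {}" "W \<subseteq> U"
      "\<And>x y. (x, y) \<in> Rel X p \<Longrightarrow> rp x y \<Longrightarrow> x \<in> W \<Longrightarrow> y \<in> U"
    using small_fibres[OF assms] by auto
  then have "\<forall>x y. (x, y) \<in> PR \<longrightarrow> x \<in> W \<longrightarrow> y \<in> U"
    using rp_iff_prox by (auto simp: PR_def)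
  then show ?thesis
    using W by blast
qed

lemma PR_topspace: "(x, y) \<in> PR \<Longrightarrow> x \<in> topspace X" "(x, y) \<in> PR \<Longrightarrow> y \<in> topspace X"
  by (auto simp: PR_def Rel_def)

lemma PR_act: "(x, y) \<in> PR \<Longrightarrow> (actX g x, actX g y) \<in> PR"
  using Rel_act prox_act PR_topspace unfolding PR_def by blast

lemma PR_refl: "x \<in> topspace X \<Longrightarrow> (x, x) \<in> PR"
  using orbit_meets_open by (auto simp: PR_def Rel_def prox_def)

lemma PR_sym: "(x, y) \<in> PR \<Longrightarrow> (y, x) \<in> PR"
  by (auto simp: PR_def Rel_def prox_def)

text \<open>By two nested uses of \<open>PR_small_fibres\<close>, once \<open>x\<close> enters
  \<open>W\<close>, \<open>y\<close> is in \<open>V\<close> and therefore \<open>z\<close> is in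
  \<open>U\<close>.\<close>

lemma PR_trans:
  assumes "(x, y) \<in> PR" "(y, z) \<in> PR"
  shows "(x, z) \<in> PR"
proof -
  have "prox x z"
    unfolding prox_def
  proof (intro allI impI)
    fix U assume "openin X U \<and> U \<noteq> {}"
    then obtain V where V: "openin X V" "V \<noteq> {}" "V \<subseteq> U" "\<And>x y. (x, y) \<in> PR \<Longrightarrow> x \<in> V \<Longrightarrow> y \<in> U"
      using PR_small_fibres[of U] by auto
    obtain W where W: "openin X W" "W \<noteq> {}" "W \<subseteq> V" "\<And>x y. (x, y) \<in> PR \<Longrightarrow> x \<in> W \<Longrightarrow> y \<in> V"
      using PR_small_fibres[OF V(1,2)] by auto
    obtain g where "actX g x \<in> W"
      using orbit_meets_open[OF PR_topspace(1)[OF assms(1)] W(1,2)] ..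
    moreover from this have "actX g y \<in> V"
      using W(4)[OF PR_act[OF assms(1)]] by simp
    then have "actX g z \<in> U"
      using V(4)[OF PR_act[OF assms(2)]] by simp
    ultimately show "\<exists>g. actX g x \<in> U \<and> actX g z \<in> U"
      using V(3) W(3) by auto
  qed
  then show ?thesis
    using assms by (auto simp: PR_def Rel_def)
qed

text \<open>On fibre pairs \<open>prox\<close> equals \<open>rp\<close>, and a failure of
  \<open>rp\<close> persists on the open rectangle that witnesses it.\<close>

lemma closedin_PR: "closedin (prod_topology X X) PR"
proof -
  define N where "N = {(x, y) \<in> topspace X \<times> topspace X. \<not> rp x y}"
  have "openin (prod_topology X X) N"
    unfolding openin_prod_topology_alt
  proof (intro allI impI)
    fix x y assume "(x, y) \<in> N"
    then obtain A B O' where AB: "openin X A" "x \<in> A" "openin X B" "y \<in> B" "openin X O'" "O' \<noteq> {}"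
        "\<And>s. meets s O' O' \<Longrightarrow> \<not> meets s A B"
      by (auto simp: N_def rp_def)
    have "\<not> rp a b" if "a \<in> A" "b \<in> B" for a b
      using AB that unfolding rp_def by metis
    then have "A \<times> B \<subseteq> N"
      using AB openin_subset[of X A] openin_subset[of X B] by (auto simp: N_def)
    then show "\<exists>A B. openin X A \<and> openin X B \<and> x \<in> A \<and> y \<in> B \<and> A \<times> B \<subseteq> N"
      using AB by metis
  qed
  moreover have "PR = Rel X p - N"
    using rp_iff_prox by (auto simp: PR_def N_def Rel_def)
  ultimately show ?thesis
    using closedin_Rel[OF HausdorffY continuous_p] by (simp add: closedin_diff)
qed

section \<open>Invariant neighbourhoods of the proximal relation\<close>

text \<open>The source of equicontinuity. Pairs that some group element brings jointly into a fixed
  nonempty open \<open>P\<close> form an open invariant set containing all proximal pairs. By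
  \<open>not_rp_separation\<close> each point of \<open>C\<close> has a neighbourhood missed by such
  a set, and by compactness finitely many of these sets are intersected.\<close>

lemma invariant_neighbourhood_of_PR:
  assumes C: "closedin (prod_topology X X) C" "C \<subseteq> Rel X p" "C \<inter> PR = {}"
  shows "\<exists>W. openin (prod_topology X X) W \<and> PR \<subseteq> W \<and> C \<inter> W = {} \<and>
    (\<forall>g x y. (x, y) \<in> W \<longrightarrow> (actX g x, actX g y) \<in> W)"
proof -
  define sep where "sep S P \<longleftrightarrow> openin (prod_topology X X) S \<and> openin X P \<and> P \<noteq> {} \<and>
    (\<forall>s. \<forall>(x, y)\<in>S. \<not> (actX s x \<in> P \<and> actX s y \<in> P))" for S P
  have "compactin (prod_topology X X) C"
    using compact C closedin_compact_space compact_space_prod_topology by blast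
  moreover have "\<exists>S P. z \<in> S \<and> sep S P" if "z \<in> C" for z
  proof -
    obtain a b where z: "z = (a, b)"
      by fastforce
    then have "(a, b) \<in> Rel X p" "(a, b) \<notin> PR"
      using that C by auto
    then have "\<not> rp a b"
      using rp_iff_prox by (auto simp: PR_def)
    then obtain A B P where "openin X A" "a \<in> A" "openin X B" "b \<in> B" "openin X P" "P \<noteq> {}"
        "\<And>s x y. x \<in> A \<Longrightarrow> y \<in> B \<Longrightarrow> \<not> (actX s x \<in> P \<and> actX s y \<in> P)"
      using not_rp_separation by metis
    then have "z \<in> A \<times> B" "sep (A \<times> B) P"
      using z by (auto simp: sep_def openin_prod_Times_iff)
    then show ?thesis
      by (intro exI conjI)
  qed
  then have "C \<subseteq> (\<Union>S\<in>{S. \<exists>P. sep S P}. S)"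
    by blast
  moreover have "openin (prod_topology X X) S" if "S \<in> {S. \<exists>P. sep S P}" for S
    using that by (auto simp: sep_def)
  ultimately obtain \<F> where \<F>: "finite \<F>" "\<F> \<subseteq> {S. \<exists>P. sep S P}" "C \<subseteq> (\<Union>S\<in>\<F>. S)"
    by (rule compactin_finite_subfamily[where f = "\<lambda>S. S"]) simp_all
  then have "\<forall>S\<in>\<F>. \<exists>P. sep S P"
    by auto
  then obtain P where "\<forall>S\<in>\<F>. sep S (P S)"
    using bchoice[of \<F> sep] by auto
  then have P: "\<And>S. S \<in> \<F> \<Longrightarrow> sep S (P S)"
    by simp
  define N where "N S = (\<Union>s. pre s (P S) \<times> pre s (P S))" for S
  define W where "W = (\<Inter>S\<in>\<F>. N S) \<inter> topspace (prod_topology X X)"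
  have memN: "(x, y) \<in> N S \<longleftrightarrow> x \<in> topspace X \<and> y \<in> topspace X \<and> (\<exists>s. actX s x \<in> P S \<and> actX s y \<in> P S)"
    for x y S
    by (auto simp: N_def pre_def)
  have "openin (prod_topology X X) (N S)" if "S \<in> \<F>" for S
    unfolding N_def using P[OF that] openin_pre by (auto simp: sep_def openin_prod_Times_iff)
  then have "openin (prod_topology X X) W"
    unfolding W_def by (intro openin_INT) (use \<F>(1) in simp_all)
  moreover have "PR \<subseteq> W"
  proof clarify
    fix x y assume xy: "(x, y) \<in> PR"
    have "(x, y) \<in> N S" if "S \<in> \<F>" for S
      using xy P[OF that] PR_topspace[OF xy] by (auto simp: memN PR_def prox_def sep_def)
    then show "(x, y) \<in> W"
      using PR_topspace[OF xy] by (simp add: W_def)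
  qed
  moreover have "C \<inter> W = {}"
  proof -
    have "z \<notin> W" if "z \<in> C" for z
    proof -
      obtain S x y where "S \<in> \<F>" "z \<in> S" "z = (x, y)"
        using \<F>(3) \<open>z \<in> C\<close> by (metis UN_E subsetD surj_pair)
      then show ?thesis
        using P[of S] by (fastforce simp: W_def memN sep_def)
    qed
    then show ?thesis
      by blast
  qed
  moreover have "(actX g x, actX g y) \<in> W" if "(x, y) \<in> W" for g x y
  proof -
    have "(actX g x, actX g y) \<in> N S" if S: "S \<in> \<F>" for S
    proof -
      obtain s where "x \<in> topspace X" "y \<in> topspace X" "actX s x \<in> P S" "actX s y \<in> P S"
        using \<open>(x, y) \<in> W\<close> S by (auto simp: W_def memN)
      then show ?thesis
        unfolding memN by (intro conjI exI[of _ "s - g"]) (simp_all flip: act_add)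
    qed
    then show ?thesis
      using that by (auto simp: W_def)
  qed
  ultimately show ?thesis
    by (intro exI[of _ W] conjI allI impI)
qed

section \<open>The quotient by the proximal relation\<close>

definition cls :: "'a \<Rightarrow> 'a set" where
  "cls x = {y. (x, y) \<in> PR}"

lemma cls_eq_iff:
  assumes "x \<in> topspace X" "y \<in> topspace X"
  shows "cls x = cls y \<longleftrightarrow> (x, y) \<in> PR"
proof
  assume "cls x = cls y"
  then show "(x, y) \<in> PR"
    using PR_refl[OF assms(2)] by (auto simp: cls_def)
next
  assume "(x, y) \<in> PR"
  then have "(x, z) \<in> PR \<longleftrightarrow> (y, z) \<in> PR" for z
    using PR_trans[of x y z] PR_trans[OF PR_sym[of x y], of z] by metis
  then show "cls x = cls y"
    by (simp add: cls_def)
qed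

lemma Rel_cls: "Rel X cls = PR"
proof -
  have "(x, y) \<in> Rel X cls \<longleftrightarrow> (x, y) \<in> PR" for x y
    using cls_eq_iff[of x y] PR_topspace[of x y] by (auto simp: Rel_def)
  then show ?thesis
    by auto
qed

lemma image_act_cls:
  assumes "x \<in> topspace X"
  shows "actX g ` cls x = cls (actX g x)"
proof
  show "actX g ` cls x \<subseteq> cls (actX g x)"
    using PR_act by (auto simp: cls_def)
  show "cls (actX g x) \<subseteq> actX g ` cls x"
  proof
    fix y assume "y \<in> cls (actX g x)"
    then have y: "(actX g x, y) \<in> PR"
      by (simp add: cls_def)
    then have "y = actX g (actX (- g) y)"
      using PR_topspace by simp
    moreover have "(x, actX (- g) y) \<in> PR"
      using PR_act[OF y, of "- g"] assms by simp
    ultimately show "y \<in> actX g ` cls x"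
      unfolding cls_def by blast
  qed
qed

abbreviation "Zt \<equiv> quot_topology X cls"

lemma quotient_cls: "quotient_map X Zt cls"
  by (rule quotient_map_quot_topology)

lemma continuous_cls: "continuous_map X Zt cls"
  by (rule quotient_imp_continuous_map[OF quotient_cls])

lemma Hausdorff_Zt: "Hausdorff_space Zt"
  using quotient_by_closed_relation(1)[OF compact Hausdorff quotient_cls] closedin_PR Rel_cls by simp

lemma compact_Zt: "compact_space Zt"
  using image_compactin[OF _ continuous_cls, of "topspace X"] compact by (simp add: compact_space_def)

text \<open>Joint continuity requires the product of the identity with \<open>cls\<close> to be a
  quotient map, which is not automatic for products. But \<open>cls\<close> maps a compact space to
  a Hausdorff one, so it is proper; the product is then proper, hence closed, hence a quotient
  map.\<close>

lemma G_system_Zt: "G_system Zt (\<lambda>g. (`) (actX g))"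
  unfolding G_system_def
proof (intro conjI ballI allI compact_Zt Hausdorff_Zt)
  have "proper_map X Zt cls"
    using continuous_imp_proper_map compact Hausdorff_imp_kc_space Hausdorff_Zt continuous_cls by blast
  then have "proper_map (prod_topology (euclidean :: 'g topology) X) (prod_topology euclidean Zt)
      (\<lambda>(g, x). (id g, cls x))"
    unfolding proper_map_prod by (intro disjI2 conjI proper_map_id)
  then have "closed_map (prod_topology (euclidean :: 'g topology) X) (prod_topology euclidean Zt)
      (\<lambda>(g, x). (id g, cls x))"
    by (rule proper_imp_closed_map)
  moreover have "continuous_map (prod_topology (euclidean :: 'g topology) X) (prod_topology euclidean Zt)
      (\<lambda>(g, x). (id g, cls x))"
    unfolding continuous_map_prod_top using continuous_cls by simp
  moreover have "(\<lambda>(g, x). (id g, cls x)) ` topspace (prod_topology (euclidean :: 'g topology) X)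
      = topspace (prod_topology euclidean Zt)"
    by force
  ultimately have quot: "quotient_map (prod_topology (euclidean :: 'g topology) X) (prod_topology euclidean Zt)
      (\<lambda>(g, x). (id g, cls x))"
    by (intro continuous_closed_imp_quotient_map)
  have "continuous_map (prod_topology euclidean X) Zt (cls \<circ> (\<lambda>(g, x). actX g x))"
    by (rule continuous_map_compose[OF continuous_action continuous_cls])
  then have "continuous_map (prod_topology euclidean X) Zt
      ((\<lambda>(g, c). actX g ` c) \<circ> (\<lambda>(g, x). (id g, cls x)))"
    by (rule continuous_map_eq) (clarsimp simp: image_act_cls)
  then show "continuous_map (prod_topology euclidean Zt) Zt (\<lambda>(g, c). actX g ` c)"
    by (rule continuous_compose_quotient_map[OF quot])
  show "actX 0 ` c = c" if "c \<in> topspace Zt" for c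
    using that by (clarsimp simp: image_act_cls)
  show "actX (g + h) ` c = actX g ` (actX h ` c)" if "c \<in> topspace Zt" for g h c
  proof -
    obtain x where "x \<in> topspace X" "c = cls x"
      using \<open>c \<in> topspace Zt\<close> by auto
    then show ?thesis
      by (simp only: image_act_cls act_add act_closed)
  qed
qed

definition phi :: "'a set \<Rightarrow> 'b" where
  "phi c = p (SOME x. x \<in> c)"

lemma phi_cls: "x \<in> topspace X \<Longrightarrow> phi (cls x) = p x"
proof -
  have same: "p y = p x" if "y \<in> cls x" for y
    using that by (simp add: cls_def PR_def Rel_def)
  assume "x \<in> topspace X"
  then have "(SOME y. y \<in> cls x) \<in> cls x"
    using PR_refl[of x] someI[of "\<lambda>y. y \<in> cls x" x] by (simp add: cls_def)
  then show ?thesis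
    unfolding phi_def by (rule same)
qed

lemma extension_cls: "extension X actX Zt (\<lambda>g. (`) (actX g)) cls"
  using continuous_cls by (simp add: extension_def image_act_cls)

lemma extension_phi: "extension Zt (\<lambda>g. (`) (actX g)) Y actY phi"
  unfolding extension_def
proof (intro conjI allI ballI)
  have "continuous_map X Y (phi \<circ> cls)"
    using continuous_p by (rule continuous_map_eq) (simp add: phi_cls)
  then show "continuous_map Zt Y phi"
    by (rule continuous_compose_quotient_map[OF quotient_cls])
  show "phi ` topspace Zt = topspace Y"
    using surj_p by (auto simp: image_image phi_cls)
  show "phi (actX g ` c) = actY g (phi c)" if "c \<in> topspace Zt" for g c
    using that by (auto simp: image_act_cls phi_cls equivariant_p)
qed

lemma equicontinuous_phi: "equicontinuous_ext Zt (\<lambda>g. (`) (actX g)) phi"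
  unfolding equicontinuous_ext_def
proof (intro allI impI)
  fix \<epsilon> assume "diag_nbhd Zt \<epsilon>"
  then obtain E where E: "openin (prod_topology Zt Zt) E" "diag Zt \<subseteq> E" "E \<subseteq> \<epsilon>"
    unfolding diag_nbhd_def by blast
  define qq where "qq = (\<lambda>(x, y). (cls x, cls y))"
  have cont: "continuous_map (prod_topology X X) (prod_topology Zt Zt) qq"
    unfolding qq_def continuous_map_prod_top using continuous_cls by simp
  have "compact_space (prod_topology X X)" "Hausdorff_space (prod_topology Zt Zt)"
    using compact Hausdorff_Zt by (simp_all add: compact_space_prod_topology Hausdorff_space_prod_topology)
  then have closed: "closed_map (prod_topology X X) (prod_topology Zt Zt) qq"
    by (rule continuous_imp_closed_map[OF cont])
  \<comment> \<open>The fibre pairs whose classes are not \<open>E\<close>-close. Proximal pairs go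
    to the diagonal, so \<open>C\<close> misses \<open>PR\<close> and an invariant neighbourhood
    \<open>W\<close> of \<open>PR\<close> can avoid \<open>C\<close>.\<close>
  define C where "C = Rel X p - {z \<in> topspace (prod_topology X X). qq z \<in> E}"
  have "closedin (prod_topology X X) C"
    unfolding C_def
    by (rule closedin_diff[OF closedin_Rel[OF HausdorffY continuous_p]
          openin_continuous_map_preimage[OF cont E(1)]])
  moreover have "C \<inter> PR = {}"
  proof -
    have "qq (x, y) \<in> E" if "(x, y) \<in> PR" for x y
      using that E(2) PR_topspace[OF that] cls_eq_iff[of x y] by (auto simp: qq_def diag_def)
    then show ?thesis
      using PR_topspace by (auto simp: C_def)
  qed
  ultimately obtain W where W: "openin (prod_topology X X) W" "PR \<subseteq> W" "C \<inter> W = {}"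
      "\<And>g x y. (x, y) \<in> W \<Longrightarrow> (actX g x, actX g y) \<in> W"
    using invariant_neighbourhood_of_PR[of C] by (auto simp: C_def)
  \<comment> \<open>The pairs of classes all of whose representatives lie in \<open>W\<close>; this
    set is open because \<open>qq\<close> is a closed map.\<close>
  define \<delta> where "\<delta> = topspace (prod_topology Zt Zt) - qq ` (topspace (prod_topology X X) - W)"
  have lift: "(x, y) \<in> W" if "x \<in> topspace X" "y \<in> topspace X" "(cls x, cls y) \<in> \<delta>" for x y
    using that by (force simp: \<delta>_def qq_def)
  have "openin (prod_topology Zt Zt) \<delta>"
    unfolding \<delta>_def using closed W(1)
    by (intro openin_diff openin_topspace) (simp only: closed_map_def closedin_diff closedin_topspace)
  moreover have "diag Zt \<subseteq> \<delta>"
  proof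
    fix z assume "z \<in> diag Zt"
    then obtain x where x: "x \<in> topspace X" "z = (cls x, cls x)"
      by (auto simp: diag_def)
    have "(a, b) \<in> W" if "a \<in> topspace X" "b \<in> topspace X" "cls a = cls x" "cls b = cls x" for a b
      using that cls_eq_iff[of a b] W(2) by auto
    then show "z \<in> \<delta>"
      using x unfolding \<delta>_def qq_def by auto
  qed
  ultimately have "diag_nbhd Zt \<delta>"
    unfolding diag_nbhd_def by (auto simp: \<delta>_def)
  \<comment> \<open>The orbit of a representative pair stays in the fibres and in the invariant
    \<open>W\<close>, hence outside \<open>C\<close>, so its image stays in \<open>E\<close>: one
    \<open>\<delta>\<close> serves all \<open>s\<close>.\<close>
  moreover have "(actX s ` c, actX s ` d) \<in> \<epsilon>" if cd: "(c, d) \<in> \<delta> \<inter> Rel Zt phi" for s c d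
  proof -
    obtain x y where xy: "x \<in> topspace X" "y \<in> topspace X" "c = cls x" "d = cls y"
      using cd by (auto simp: Rel_def)
    then have "(x, y) \<in> Rel X p"
      using cd by (auto simp: Rel_def phi_cls)
    moreover have "(x, y) \<in> W"
      using cd xy lift by blast
    ultimately have "(actX s x, actX s y) \<in> Rel X p" "(actX s x, actX s y) \<notin> C"
      using W Rel_act by blast+
    then have "qq (actX s x, actX s y) \<in> E"
      by (auto simp: C_def)
    then show ?thesis
      using E(3) xy by (auto simp: qq_def image_act_cls)
  qed
  ultimately show "\<exists>\<delta>. diag_nbhd Zt \<delta> \<and>
      (\<forall>s. (\<lambda>(z1, z2). (actX s ` z1, actX s ` z2)) ` (\<delta> \<inter> Rel Zt phi) \<subseteq> \<epsilon>)"
    by (intro exI[of _ \<delta>]) auto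
qed

lemma PE_decomposition_exists:
  "PE_decomposition X actX Y actY p Zt (\<lambda>g. (`) (actX g)) cls phi"
  unfolding PE_decomposition_def proximal_ext_iff Rel_cls
  using G_system_Zt extension_cls extension_phi equicontinuous_phi
  by (auto simp: phi_cls PR_def)

section \<open>Uniqueness and high proximality\<close>

text \<open>Proximality of \<open>psi\<close> gives one inclusion. For the other, suppose a proximal
  pair had distinct images: these could be brought \<open>\<delta>\<close>-close by some
  \<open>g\<close>, and moving back by \<open>- g\<close> would contradict equicontinuity of
  \<open>phi'\<close>.\<close>

lemma PE_decomposition_Rel:
  assumes "PE_decomposition X actX Y actY p Z actZ psi phi'"
  shows "Rel X psi = PR"
proof -
  have ext: "extension X actX Z actZ psi" and ph: "\<And>x. x \<in> topspace X \<Longrightarrow> p x = phi' (psi x)"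
    and prox: "\<And>x y. (x, y) \<in> Rel X psi \<Longrightarrow> prox x y"
    and eqc: "equicontinuous_ext Z actZ phi'" and G: "G_system Z actZ"
    using assms by (auto simp: PE_decomposition_def proximal_ext_iff)
  have cont: "continuous_map X Z psi"
    and eqv: "\<And>g x. x \<in> topspace X \<Longrightarrow> psi (actX g x) = actZ g (psi x)"
    and psi_top: "\<And>x. x \<in> topspace X \<Longrightarrow> psi x \<in> topspace Z"
    using ext by (auto simp: extension_def)
  have collapse: "psi x = psi y" if "(x, y) \<in> PR" for x y
  proof (rule ccontr)
    assume ne: "psi x \<noteq> psi y"
    have top: "x \<in> topspace X" "y \<in> topspace X"
      using that PR_topspace by auto
    \<comment> \<open>A neighbourhood of the diagonal because the images are distinct; it omits
      precisely the pair that moving back produces.\<close>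
    define \<epsilon> where "\<epsilon> = topspace (prod_topology Z Z) - {(psi x, psi y)}"
    have "t1_space (prod_topology Z Z)"
      using G by (simp add: G_system_def Hausdorff_imp_t1_space Hausdorff_space_prod_topology)
    then have "closedin (prod_topology Z Z) {(psi x, psi y)}"
      using top psi_top by (simp add: closedin_t1_singleton)
    then have "openin (prod_topology Z Z) \<epsilon>"
      unfolding \<epsilon>_def by (intro openin_diff openin_topspace)
    then have "diag_nbhd Z \<epsilon>"
      using ne by (auto simp: diag_nbhd_def \<epsilon>_def diag_def)
    then obtain \<delta> where \<delta>: "diag_nbhd Z \<delta>"
        "\<And>s. (\<lambda>(z1, z2). (actZ s z1, actZ s z2)) ` (\<delta> \<inter> Rel Z phi') \<subseteq> \<epsilon>"
      using eqc unfolding equicontinuous_ext_def by blast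
    then obtain D where D: "openin (prod_topology Z Z) D" "diag Z \<subseteq> D" "D \<subseteq> \<delta>"
      unfolding diag_nbhd_def by blast
    have "(psi x, psi x) \<in> D"
      using D(2) top psi_top by (auto simp: diag_def)
    then obtain A B where "openin Z A" "openin Z B" "psi x \<in> A" "psi x \<in> B" "A \<times> B \<subseteq> D"
      using D(1) unfolding openin_prod_topology_alt by metis
    moreover define U where "U = {x \<in> topspace X. psi x \<in> A \<inter> B}"
    ultimately have "openin X U" "U \<noteq> {}"
      using top openin_continuous_map_preimage[OF cont, of "A \<inter> B"] by auto
    then obtain g where g: "actX g x \<in> U" "actX g y \<in> U"
      using \<open>(x, y) \<in> PR\<close> by (auto simp: PR_def prox_def)
    have "(psi (actX g x), psi (actX g y)) \<in> \<delta>"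
      using g \<open>A \<times> B \<subseteq> D\<close> D(3) by (auto simp: U_def)
    moreover have "(psi (actX g x), psi (actX g y)) \<in> Rel Z phi'"
      using Rel_act[of x y g] that psi_top top ph by (auto simp: Rel_def PR_def)
    ultimately have "(actZ (- g) (psi (actX g x)), actZ (- g) (psi (actX g y))) \<in> \<epsilon>"
      using \<delta>(2)[of "- g"] by auto
    moreover have "actZ (- g) (psi (actX g x)) = psi x" "actZ (- g) (psi (actX g y)) = psi y"
      using eqv top by (simp_all flip: eqv)
    ultimately show False
      by (simp add: \<epsilon>_def)
  qed
  show ?thesis
  proof (intro set_eqI iffI; clarify)
    fix x y assume "(x, y) \<in> Rel X psi"
    then show "(x, y) \<in> PR"
      using prox[of x y] ph[of x] ph[of y] by (simp add: PR_def Rel_def)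
  next
    fix x y assume "(x, y) \<in> PR"
    then show "(x, y) \<in> Rel X psi"
      using PR_topspace[of x y] collapse[of x y] by (simp add: Rel_def)
  qed
qed

lemma PE_decomposition_quotient_map:
  assumes "PE_decomposition X actX Y actY p Z actZ psi phi'"
  shows "quotient_map X Z psi"
  using assms continuous_imp_quotient_map[of X Z psi] compact
  by (auto simp: PE_decomposition_def extension_def G_system_def)

text \<open>Both first maps are quotient maps of \<open>X\<close> that collapse exactly
  \<open>PR\<close>, so their targets agree; the other identities are checked on images of points of
  \<open>X\<close>.\<close>

lemma PE_decomposition_unique:
  assumes 1: "PE_decomposition X actX Y actY p Z actZ psi phi1"
    and 2: "PE_decomposition X actX Y actY p Z' actZ' psi' phi2"
  shows "\<exists>h. homeomorphic_map Z Z' h \<and> (\<forall>g. \<forall>z\<in>topspace Z. h (actZ g z) = actZ' g (h z)) \<and>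
    (\<forall>x\<in>topspace X. h (psi x) = psi' x) \<and> (\<forall>z\<in>topspace Z. phi2 (h z) = phi1 z)"
proof -
  obtain h where h: "homeomorphic_map Z Z' h" "\<And>x. x \<in> topspace X \<Longrightarrow> h (psi x) = psi' x"
    using homeomorphic_quotients[OF PE_decomposition_quotient_map[OF 1]
        PE_decomposition_quotient_map[OF 2]] PE_decomposition_Rel[OF 1] PE_decomposition_Rel[OF 2]
    by auto
  have img: "topspace Z = psi ` topspace X"
    and eqv: "\<And>g x. x \<in> topspace X \<Longrightarrow> psi (actX g x) = actZ g (psi x)"
      "\<And>g x. x \<in> topspace X \<Longrightarrow> psi' (actX g x) = actZ' g (psi' x)"
    and ph: "\<And>x. x \<in> topspace X \<Longrightarrow> phi1 (psi x) = p x" "\<And>x. x \<in> topspace X \<Longrightarrow> phi2 (psi' x) = p x"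
    using 1 2 by (auto simp: PE_decomposition_def extension_def)
  have "h (actZ g z) = actZ' g (h z)" if "z \<in> topspace Z" for g z
    using that h(2) by (auto simp: img simp flip: eqv)
  moreover have "phi2 (h z) = phi1 z" if "z \<in> topspace Z" for z
    using that h(2) by (auto simp: img ph)
  ultimately show ?thesis
    using h by blast
qed

text \<open>Minimality moves one point of the fibre into the \<open>W\<close> of
  \<open>PR_small_fibres\<close>; the whole fibre, being related to it, follows into
  \<open>U\<close>.\<close>

lemma PE_decomposition_highly_proximal:
  assumes "PE_decomposition X actX Y actY p Z actZ psi phi'"
  shows "highly_proximal_ext X actX Z psi"
  unfolding highly_proximal_ext_def
proof (intro allI impI ballI)
  fix U z assume U: "openin X U \<and> U \<noteq> {}" and z: "z \<in> topspace Z"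
  have "psi ` topspace X = topspace Z"
    using assms by (simp add: PE_decomposition_def extension_def)
  then obtain x where x: "x \<in> topspace X" "z = psi x"
    using z by auto
  obtain W where W: "openin X W" "W \<noteq> {}" "\<And>x y. (x, y) \<in> PR \<Longrightarrow> x \<in> W \<Longrightarrow> y \<in> U"
    using PR_small_fibres[of U] U by auto
  obtain g where g: "actX g x \<in> W"
    using orbit_meets_open[OF x(1) W(1,2)] ..
  have "y \<in> actX (- g) ` U" if "y \<in> topspace X" "psi y = z" for y
  proof -
    have "(x, y) \<in> PR"
      using x that PE_decomposition_Rel[OF assms] by (auto simp: Rel_def)
    then have "actX g y \<in> U"
      using W(3)[OF PR_act g] by simp
    then show ?thesis
      using that by (intro image_eqI[of _ _ "actX g y"]) simp_all
  qed
  then show "\<exists>s. {x \<in> topspace X. psi x = z} \<subseteq> actX s ` U"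
    by (intro exI[of _ "- g"]) auto
qed

end

theorem theorem7p15:
  fixes X :: "'a topology" and actX :: "'g::topological_ab_group_add \<Rightarrow> 'a \<Rightarrow> 'a"
    and Y :: "'b topology" and actY :: "'g \<Rightarrow> 'b \<Rightarrow> 'b"
    and p :: "'a \<Rightarrow> 'b"
  assumes "minimal_G_system X actX" and "minimal_G_system Y actY"
    and "extension X actX Y actY p" and "tame_ext X actX p"
  shows
    "(\<exists>(Z :: 'a set topology) actZ psi phi. PE_decomposition X actX Y actY p Z actZ psi phi)
     \<and> (\<forall>(Z :: 'c topology) actZ psi phi (Z' :: 'd topology) actZ' psi' phi'.
          PE_decomposition X actX Y actY p Z actZ psi phi \<and>
          PE_decomposition X actX Y actY p Z' actZ' psi' phi' \<longrightarrow>
          (\<exists>h. homeomorphic_map Z Z' h \<and>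
               (\<forall>g. \<forall>z\<in>topspace Z. h (actZ g z) = actZ' g (h z)) \<and>
               (\<forall>x\<in>topspace X. h (psi x) = psi' x) \<and>
               (\<forall>z\<in>topspace Z. phi' (h z) = phi z)))
     \<and> (\<forall>(Z :: 'c topology) actZ psi phi.
          PE_decomposition X actX Y actY p Z actZ psi phi \<and>
          (metrizable_space X \<or> (open_map X Y p \<and> metrizable_space Y)) \<longrightarrow>
          highly_proximal_ext X actX Z psi)"
  proof -
  interpret tame_extension X actX Y actY p
    using assms by unfold_locales (auto simp: minimal_G_system_def G_system_def)
  show ?thesis
    by (intro conjI allI impI; (elim conjE)?)
      (rule exI, rule exI, rule exI, rule exI, rule PE_decomposition_exists,
       erule PE_decomposition_unique, assumption, erule PE_decomposition_highly_proximal)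
qed

end
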